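(* Let $L$, $\mathcal{P}_L$, $G$ and $\mathcal{V}\subset\mathcal{N}_L\cap L^\vee$ be as in the context, with $\mathcal{V}$ satisfying (V1)–(V4). Let $f\in\overline{\mathcal{P}}_L\cap L$ be non-zero with $f^2=0$ and $b=\mathbb{R}_{>0}f$. Then there exists $\alpha_0>0$ such that for every $0<\alpha\le\alpha_0$ and every compact subset $J$ of the horosphere $\partial\mathrm{HB}_b(\alpha)$, the number of $\mathcal{V}^*$-chambers that intersect the subset $\pi_L^{-1}(\rho_b^{-1}(J))$ of $\mathcal{P}_L$ is finite.
   Context: $L$ is an even hyperbolic lattice (free $\mathbb{Z}$-module of rank $n>1$ with non-degenerate even symmetric bilinear form $\langle\ ,\ \rangle$ of signature $(1,n-1)$, extended to $L\otimes\mathbb{R}$); $L^\vee$ its dual lattice; $\mathcal{P}_L$ a connected component of $\{x:x^2>0\}$, $\overline{\mathcal{P}}_L$ its closure; $\mathrm{O}^+(L)$ the isometries preserving $\mathcal{P}_L$; $G\subset\mathrm{O}^+(L)$ a subgroup of finite index. $\mathcal{N}_L=\{v: v^2<0\}$, $(v)^\perp=\{x\in\mathcal{P}_L:\langle x,v\rangle=0\}$, $\Sigma_L(\Delta)=\{x:\langle x,v\rangle\ge0\ \forall v\in\Delta\}$. A $\mathcal{V}^*$-chamber is the closure in $\mathcal{P}_L$ of a connected component of $\mathcal{P}_L\setminus\bigcup_{v\in\mathcal{V}}(v)^\perp$; a defining set of such $D$ is $\Delta\subset\mathcal{N}_L\cap L^\vee$ with $D=\Sigma_L(\Delta)\cap\mathcal{P}_L$.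 Conditions: (V1) there is $c>0$ with $-v^2<c$ for all $v\in\mathcal{V}$; (V2) $\mathcal{V}$ is $G$-invariant; (V3) every $\mathcal{V}^*$-chamber has a finite defining set; (V4) for every $\mathcal{V}^*$-chamber $D$, every non-zero $x$ in the closure of $D$ in $L\otimes\mathbb{R}$ with $x^2=0$ is a positive real multiple of a vector of $L$. $\mathcal{H}_L=\mathcal{P}_L/\mathbb{R}_{>0}$ with projection $\pi_L$. $\mathrm{HB}_b(\alpha)=\pi_L(\{x\in\mathcal{P}_L:\langle x,f\rangle^2/x^2\le\alpha\})$ is the closed horoball, $\partial\mathrm{HB}_b(\alpha)$ the horosphere where equality holds (a Euclidean affine space), and $\rho_b:\mathrm{HB}_b(\alpha)\to\partial\mathrm{HB}_b(\alpha)$ sends $p$ to the point of $\partial\mathrm{HB}_b(\alpha)$ on the geodesic through $p$ passing through $b$ at infinity. *)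

theory Defs
  imports "HOL-Analysis.Analysis"
begin

text \<open>The lattice L is modelled as the integer points of real^'n (a basis of L is fixed),
  and the bilinear form is given by its Gram matrix Q (a real matrix with integer entries).\<close>

definition bil :: "real^'n^'n \<Rightarrow> real^'n \<Rightarrow> real^'n \<Rightarrow> real" where
  "bil Q x y = x \<bullet> (Q *v y)"

definition lat :: "(real^'n) set" where
  "lat = {x. \<forall>i. x $ i \<in> \<int>}"

definition dual_lat :: "real^'n^'n \<Rightarrow> (real^'n) set" where
  "dual_lat Q = {v. \<forall>x\<in>lat. bil Q v x \<in> \<int>}"

text \<open>Even hyperbolic lattice of rank n > 1: integral symmetric Gram matrix with even diagonal,
  non-degenerate, of signature (1, n-1) (Sylvester normal form).\<close>
definition even_hyperbolic :: "real^'n::finite^'n \<Rightarrow> bool" where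
  "even_hyperbolic Q \<longleftrightarrow>
     CARD('n) > 1 \<and>
     (\<forall>i j. Q $ i $ j \<in> \<int>) \<and> transpose Q = Q \<and>
     (\<forall>i. \<exists>k::int. Q $ i $ i = 2 * of_int k) \<and>
     det Q \<noteq> 0 \<and>
     (\<exists>(M::real^'n^'n) i0. invertible M \<and>
        transpose M ** Q ** M = (\<chi> i j. if i = j then (if i = i0 then 1 else -1) else 0))"

text \<open>P is a connected component of the positive set {x. x^2 > 0}.\<close>
definition pos_component :: "real^'n^'n \<Rightarrow> (real^'n) set \<Rightarrow> bool" where
  "pos_component Q P \<longleftrightarrow>
     (\<exists>x0. bil Q x0 x0 > 0 \<and> P = connected_component_set {x. bil Q x x > 0} x0)"

definition neg_vecs :: "real^'n^'n \<Rightarrow> (real^'n) set" where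
  "neg_vecs Q = {v. bil Q v v < 0}"

text \<open>O^+(L): isometries of L preserving P (as matrices acting on real^'n).\<close>
definition Oplus :: "real^'n^'n \<Rightarrow> (real^'n) set \<Rightarrow> (real^'n^'n) set" where
  "Oplus Q P = {g. (\<forall>x y. bil Q (g *v x) (g *v y) = bil Q x y) \<and>
                  (\<lambda>x. g *v x) ` lat = lat \<and> (\<lambda>x. g *v x) ` P = P}"

definition finite_index_subgroup ::
    "real^'n^'n \<Rightarrow> (real^'n) set \<Rightarrow> (real^'n^'n) set \<Rightarrow> bool" where
  "finite_index_subgroup Q P G \<longleftrightarrow>
     G \<subseteq> Oplus Q P \<and> mat 1 \<in> G \<and>
     (\<forall>g\<in>G. \<forall>h\<in>G. g ** h \<in> G) \<and> (\<forall>g\<in>G. matrix_inv g \<in> G) \<and>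
     finite {(\<lambda>h. g ** h) ` G | g. g \<in> Oplus Q P}"

definition perp :: "real^'n^'n \<Rightarrow> (real^'n) set \<Rightarrow> real^'n \<Rightarrow> (real^'n) set" where
  "perp Q P v = {x\<in>P. bil Q x v = 0}"

definition Sigma_L :: "real^'n^'n \<Rightarrow> (real^'n) set \<Rightarrow> (real^'n) set" where
  "Sigma_L Q \<Delta> = {x. \<forall>v\<in>\<Delta>. bil Q x v \<ge> 0}"

text \<open>V*-chamber: closure in P of a connected component of P minus the walls.\<close>
definition is_chamber ::
    "real^'n^'n \<Rightarrow> (real^'n) set \<Rightarrow> (real^'n) set \<Rightarrow> (real^'n) set \<Rightarrow> bool" where
  "is_chamber Q P V D \<longleftrightarrow>
     (\<exists>x. x \<in> P - (\<Union>v\<in>V. perp Q P v) \<and>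
          D = closure (connected_component_set (P - (\<Union>v\<in>V. perp Q P v)) x) \<inter> P)"

definition defining_set ::
    "real^'n^'n \<Rightarrow> (real^'n) set \<Rightarrow> (real^'n) set \<Rightarrow> (real^'n) set \<Rightarrow> bool" where
  "defining_set Q P D \<Delta> \<longleftrightarrow> \<Delta> \<subseteq> neg_vecs Q \<inter> dual_lat Q \<and> D = Sigma_L Q \<Delta> \<inter> P"

definition V1 :: "real^'n^'n \<Rightarrow> (real^'n) set \<Rightarrow> bool" where
  "V1 Q V \<longleftrightarrow> (\<exists>c>0. \<forall>v\<in>V. - bil Q v v < c)"

definition V2 :: "(real^'n^'n) set \<Rightarrow> (real^'n) set \<Rightarrow> bool" where
  "V2 G V \<longleftrightarrow> (\<forall>g\<in>G. \<forall>v\<in>V. g *v v \<in> V)"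

definition V3 :: "real^'n^'n \<Rightarrow> (real^'n) set \<Rightarrow> (real^'n) set \<Rightarrow> bool" where
  "V3 Q P V \<longleftrightarrow> (\<forall>D. is_chamber Q P V D \<longrightarrow> (\<exists>\<Delta>. finite \<Delta> \<and> defining_set Q P D \<Delta>))"

definition V4 :: "real^'n^'n \<Rightarrow> (real^'n) set \<Rightarrow> (real^'n) set \<Rightarrow> bool" where
  "V4 Q P V \<longleftrightarrow> (\<forall>D. is_chamber Q P V D \<longrightarrow>
     (\<forall>x\<in>closure D. x \<noteq> 0 \<and> bil Q x x = 0 \<longrightarrow> (\<exists>t>0. \<exists>y\<in>lat. x = t *\<^sub>R y)))"

text \<open>Hyperbolic space H_L = P / R_{>0}, realised as the hyperboloid sheet {x in P. x^2 = 1};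
  the projection pi_L sends x to x / sqrt(x^2).\<close>
definition piL :: "real^'n^'n \<Rightarrow> real^'n \<Rightarrow> real^'n" where
  "piL Q x = (1 / sqrt (bil Q x x)) *\<^sub>R x"

definition horoball ::
    "real^'n^'n \<Rightarrow> (real^'n) set \<Rightarrow> real^'n \<Rightarrow> real \<Rightarrow> (real^'n) set" where
  "horoball Q P f \<alpha> = piL Q ` {x\<in>P. (bil Q x f)\<^sup>2 / bil Q x x \<le> \<alpha>}"

definition horosphere ::
    "real^'n^'n \<Rightarrow> (real^'n) set \<Rightarrow> real^'n \<Rightarrow> real \<Rightarrow> (real^'n) set" where
  "horosphere Q P f \<alpha> = piL Q ` {x\<in>P. (bil Q x f)\<^sup>2 / bil Q x x = \<alpha>}"

text \<open>The geodesic through p having the boundary point b = R_{>0} f at infinity: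
  the image in H_L of the 2-plane spanned by p and f.\<close>
definition geodesic_to ::
    "real^'n^'n \<Rightarrow> (real^'n) set \<Rightarrow> real^'n \<Rightarrow> real^'n \<Rightarrow> (real^'n) set" where
  "geodesic_to Q P f p = piL Q ` (span {p, f} \<inter> P)"

definition rho ::
    "real^'n^'n \<Rightarrow> (real^'n) set \<Rightarrow> real^'n \<Rightarrow> real \<Rightarrow> real^'n \<Rightarrow> real^'n" where
  "rho Q P f \<alpha> p = (THE q. q \<in> horosphere Q P f \<alpha> \<and> q \<in> geodesic_to Q P f p)"

end

theory Submission
  imports Defs
begin

text \<open>Normalising points of P to the slice \<open>\<langle>z, f\<rangle> = 1\<close> gives the upper half space model
  with b at infinity, in which the horospheres centred at b are the level sets of \<open>\<langle>z, z\<rangle>\<close>.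
  For \<open>\<alpha> < 1/c\<close>, the part of the horoball projecting under \<open>\<rho>\<^sub>b\<close> into a compact J lies in an open
  convex region U of P whose slice image stays inside \<open>\<langle>z, z\<rangle> > c\<close> and within bounded distance
  of J modulo f. A wall \<open>v\<^sup>\<perp>\<close> (\<open>v \<in> V\<close>, \<open>-v\<^sup>2 < c\<close>) meeting U contains f, since \<open>\<langle>v, f\<rangle>\<close> is an
  integer of absolute value less than 1 by the reverse Cauchy--Schwarz inequality; it then
  contains a unit timelike vector from a bounded set, which leaves only finitely many possible v
  in the dual lattice. Finally, a convex set crossed by finitely many walls meets only finitely
  many chambers.\<close>

section \<open>The bilinear form\<close>

lemma bil_add_left [simp]: "bil Q (x + y) z = bil Q x z + bil Q y z"
  by (simp add: bil_def inner_add_left)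

lemma bil_add_right [simp]: "bil Q z (x + y) = bil Q z x + bil Q z y"
  by (simp add: bil_def matrix_vector_right_distrib inner_add_right)

lemma bil_diff_left [simp]: "bil Q (x - y) z = bil Q x z - bil Q y z"
  by (simp add: bil_def inner_diff_left)

lemma bil_diff_right [simp]: "bil Q z (x - y) = bil Q z x - bil Q z y"
  by (simp add: bil_def matrix_vector_mult_diff_distrib inner_diff_right)

lemma bil_scaleR_left [simp]: "bil Q (c *\<^sub>R x) z = c * bil Q x z"
  by (simp add: bil_def)

lemma bil_scaleR_right [simp]: "bil Q z (c *\<^sub>R x) = c * bil Q z x"
  by (simp add: bil_def matrix_vector_mult_scaleR)

lemma bil_zero_left [simp]: "bil Q 0 z = 0"
  and bil_zero_right [simp]: "bil Q z 0 = 0"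
  by (simp_all add: bil_def)

lemma bil_commute:
  assumes "transpose Q = Q"
  shows "bil Q x y = bil Q y x"
proof -
  have "bil Q x y = (transpose Q *v x) \<bullet> y"
    by (simp add: bil_def dot_lmul_matrix transpose_matrix_vector)
  then show ?thesis
    using assms by (simp add: bil_def inner_commute)
qed

lemma bil_matrix_vector_mult:
  "bil Q (M *v y) (M *v w) = y \<bullet> ((transpose M ** Q ** M) *v w)"
proof -
  have "bil Q (M *v y) (M *v w) = ((Q *v (M *v w)) v* M) \<bullet> y"
    by (metis bil_def dot_lmul_matrix inner_commute)
  also have "\<dots> = (transpose M *v (Q *v (M *v w))) \<bullet> y"
    by (simp add: transpose_matrix_vector)
  also have "\<dots> = y \<bullet> ((transpose M ** Q ** M) *v w)"
    by (simp add: matrix_vector_mul_assoc inner_commute matrix_mul_assoc)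
  finally show ?thesis .
qed

lemma bil_convex_combination:
  "bil Q (u *\<^sub>R x + (1 - u) *\<^sub>R y) (u *\<^sub>R x + (1 - u) *\<^sub>R y)
     = u * bil Q x x + (1 - u) * bil Q y y - u * (1 - u) * bil Q (x - y) (x - y)"
  by (simp add: algebra_simps)

lemma continuous_on_bil [continuous_intros]:
  assumes "continuous_on S f" "continuous_on S g"
  shows "continuous_on S (\<lambda>x. bil Q (f x) (g x))"
  unfolding bil_def
  by (intro continuous_intros assms bounded_linear.continuous_on[OF matrix_vector_mul_bounded_linear])

lemma bil_bound:
  obtains K where "K > 0" "\<And>x y. \<bar>bil Q x y\<bar> \<le> norm x * norm y * K"
proof -
  obtain K where K: "K > 0" "\<And>y. norm (Q *v y) \<le> norm y * K"
    using bounded_linear.pos_bounded[OF matrix_vector_mul_bounded_linear] by blast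
  have "\<bar>bil Q x y\<bar> \<le> norm x * norm y * K" for x y
  proof -
    have "\<bar>bil Q x y\<bar> \<le> norm x * norm (Q *v y)"
      unfolding bil_def by (rule Cauchy_Schwarz_ineq2)
    also have "\<dots> \<le> norm x * (norm y * K)"
      by (intro mult_left_mono K(2)) simp
    finally show ?thesis by (simp add: mult.assoc)
  qed
  with K(1) that show ?thesis by blast
qed

section \<open>Signature (1, n-1)\<close>

definition drop_coord :: "'n \<Rightarrow> real^'n \<Rightarrow> real^'n" where
  "drop_coord i0 y = (\<chi> i. if i = i0 then 0 else y $ i)"

lemma inner_signature_matrix:
  fixes y w :: "real^'n"
  shows "y \<bullet> ((\<chi> i j. if i = j then (if i = i0 then 1 else -1) else 0) *v w)
     = y $ i0 * w $ i0 - drop_coord i0 y \<bullet> drop_coord i0 w"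
proof -
  have "((\<chi> i j. if i = j then (if i = i0 then 1 else -1) else 0) *v w) $ i
        = (if i = i0 then w $ i else - w $ i)" for i
    by (simp add: matrix_vector_mult_def if_distrib[of "\<lambda>a. a * _"] cong: if_cong)
  then have "y \<bullet> ((\<chi> i j. if i = j then (if i = i0 then 1 else -1) else 0) *v w)
      = (\<Sum>i\<in>UNIV. if i = i0 then y $ i * w $ i else 0)
        - (\<Sum>i\<in>UNIV. if i = i0 then 0 else y $ i * w $ i)"
    unfolding inner_vec_def sum_subtractf[symmetric] by (intro sum.cong) auto
  then show ?thesis
    by (simp add: drop_coord_def inner_vec_def if_distrib[of "\<lambda>a. a * _"] cong: if_cong)
qed

lemma zero_iff_drop_coord: "y = 0 \<longleftrightarrow> y $ i0 = 0 \<and> drop_coord i0 y = 0"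
  by (auto simp: drop_coord_def vec_eq_iff)

lemma hyperbolic_coordinates:
  fixes Q :: "real^'n^'n"
  assumes "even_hyperbolic Q"
  obtains M :: "real^'n^'n" and i0
  where "\<And>x. \<exists>y. x = M *v y" and "\<And>y. M *v y = 0 \<longleftrightarrow> y = 0"
    and "\<And>y w. bil Q (M *v y) (M *v w) = y $ i0 * w $ i0 - drop_coord i0 y \<bullet> drop_coord i0 w"
proof -
  obtain M :: "real^'n^'n" and i0 where M: "invertible M"
    and MQM: "transpose M ** Q ** M = (\<chi> i j. if i = j then (if i = i0 then 1 else -1) else 0)"
    using assms unfolding even_hyperbolic_def by blast
  obtain M' :: "real^'n^'n" where "M ** M' = mat 1"
    using M unfolding invertible_def by blast
  then have "x = M *v (M' *v x)" for x
    by (simp add: matrix_vector_mul_assoc)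
  moreover have "M *v y = 0 \<longleftrightarrow> y = 0" for y
    using inj_matrix_vector_mult[OF M] by (metis injD matrix_vector_mult_0_right)
  moreover have "bil Q (M *v y) (M *v w) = y $ i0 * w $ i0 - drop_coord i0 y \<bullet> drop_coord i0 w"
    for y w
    unfolding bil_matrix_vector_mult MQM inner_signature_matrix ..
  ultimately show thesis
    using that by blast
qed

text \<open>In Minkowski coordinates \<open>\<langle>(a, Y), (b, W)\<rangle> = a b - Y \<bullet> W\<close>: a vector orthogonal to a
  causal vector is not timelike, and one orthogonal to a timelike vector is spacelike or zero.\<close>
lemma orthogonal_to_causal_coords:
  fixes a b :: real and Y W :: "'a::real_inner"
  assumes causal: "Y \<bullet> Y \<le> a\<^sup>2" and nonzero: "a \<noteq> 0 \<or> Y \<noteq> 0" and orth: "b * a = W \<bullet> Y"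
  shows "b\<^sup>2 \<le> W \<bullet> W"
    and "Y \<bullet> Y < a\<^sup>2 \<Longrightarrow> b \<noteq> 0 \<or> W \<noteq> 0 \<Longrightarrow> b\<^sup>2 < W \<bullet> W"
proof -
  have le: "b\<^sup>2 * a\<^sup>2 \<le> (W \<bullet> W) * (Y \<bullet> Y)"
    using Cauchy_Schwarz_ineq[of W Y] orth by (metis power_mult_distrib)
  have a: "a\<^sup>2 > 0"
  proof (rule ccontr)
    assume "\<not> a\<^sup>2 > 0"
    then have "a = 0"
      by simp
    then have "Y \<bullet> Y \<le> 0"
      using causal by simp
    then show False
      using nonzero \<open>a = 0\<close> by (metis inner_eq_zero_iff inner_ge_zero order_antisym)
  qed
  have "(W \<bullet> W) * (Y \<bullet> Y) \<le> (W \<bullet> W) * a\<^sup>2"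
    using causal by (simp add: mult_left_mono)
  with le have "b\<^sup>2 * a\<^sup>2 \<le> (W \<bullet> W) * a\<^sup>2"
    by linarith
  then show "b\<^sup>2 \<le> W \<bullet> W"
    using a by simp
  assume timelike: "Y \<bullet> Y < a\<^sup>2" and "b \<noteq> 0 \<or> W \<noteq> 0"
  then have "W \<noteq> 0"
    using orth a by auto
  then have "(W \<bullet> W) * (Y \<bullet> Y) < (W \<bullet> W) * a\<^sup>2"
    using timelike by simp
  then show "b\<^sup>2 < W \<bullet> W"
    using le a by (meson mult_less_cancel_right_pos order_le_less_trans)
qed

lemma bil_orthogonal_timelike_neg:
  fixes Q :: "real^'n^'n"
  assumes eh: "even_hyperbolic Q" and "bil Q x x > 0" "bil Q u x = 0" "u \<noteq> 0"
  shows "bil Q u u < 0"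
proof -
  obtain M :: "real^'n^'n" and i0 :: 'n where surj: "\<And>x. \<exists>y. x = M *v y" and M0: "\<And>y. M *v y = 0 \<longleftrightarrow> y = 0"
    and coords: "\<And>y w. bil Q (M *v y) (M *v w) = y $ i0 * w $ i0 - drop_coord i0 y \<bullet> drop_coord i0 w"
    using hyperbolic_coordinates[OF eh] by blast
  obtain y w where xy: "x = M *v y" and uw: "u = M *v w"
    using surj[of x] surj[of u] by blast
  have "(w $ i0)\<^sup>2 < drop_coord i0 w \<bullet> drop_coord i0 w"
  proof (rule orthogonal_to_causal_coords(2))
    show "drop_coord i0 y \<bullet> drop_coord i0 y < (y $ i0)\<^sup>2"
      using assms(2) coords[of y y] xy by (simp add: power2_eq_square)
    then show "drop_coord i0 y \<bullet> drop_coord i0 y \<le> (y $ i0)\<^sup>2"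
      by simp
    show "y $ i0 \<noteq> 0 \<or> drop_coord i0 y \<noteq> 0"
      using assms(2) xy M0[of y] zero_iff_drop_coord[of y i0] by force
    show "w $ i0 * y $ i0 = drop_coord i0 w \<bullet> drop_coord i0 y"
      using assms(3) coords[of w y] xy uw by simp
    show "w $ i0 \<noteq> 0 \<or> drop_coord i0 w \<noteq> 0"
      using assms(4) uw M0[of w] zero_iff_drop_coord[of w i0] by simp
  qed
  then show ?thesis
    using coords[of w w] uw by (simp add: power2_eq_square)
qed

lemma bil_orthogonal_causal_nonpos:
  fixes Q :: "real^'n^'n"
  assumes eh: "even_hyperbolic Q" and "bil Q x x \<ge> 0" "x \<noteq> 0" "bil Q u x = 0"
  shows "bil Q u u \<le> 0"
proof -
  obtain M :: "real^'n^'n" and i0 :: 'n where surj: "\<And>x. \<exists>y. x = M *v y" and M0: "\<And>y. M *v y = 0 \<longleftrightarrow> y = 0"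
    and coords: "\<And>y w. bil Q (M *v y) (M *v w) = y $ i0 * w $ i0 - drop_coord i0 y \<bullet> drop_coord i0 w"
    using hyperbolic_coordinates[OF eh] by blast
  obtain y w where xy: "x = M *v y" and uw: "u = M *v w"
    using surj[of x] surj[of u] by blast
  have "(w $ i0)\<^sup>2 \<le> drop_coord i0 w \<bullet> drop_coord i0 w"
  proof (rule orthogonal_to_causal_coords(1))
    show "drop_coord i0 y \<bullet> drop_coord i0 y \<le> (y $ i0)\<^sup>2"
      using assms(2) coords[of y y] xy by (simp add: power2_eq_square)
    show "y $ i0 \<noteq> 0 \<or> drop_coord i0 y \<noteq> 0"
      using assms(3) xy M0[of y] zero_iff_drop_coord[of y i0] by simp
    show "w $ i0 * y $ i0 = drop_coord i0 w \<bullet> drop_coord i0 y"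
      using assms(4) coords[of w y] xy uw by simp
  qed
  then show ?thesis
    using coords[of w w] uw by (simp add: power2_eq_square)
qed

lemma quadratic_nonpos_discriminant:
  fixes A B C :: real
  assumes "\<And>t. A + 2 * t * B + t\<^sup>2 * C \<le> 0" "C \<le> 0"
  shows "B\<^sup>2 \<le> A * C"
proof (cases "C = 0")
  case True
  have "B = 0"
  proof (rule ccontr)
    assume "B \<noteq> 0"
    then show False
      using assms(1)[of "(1 - A) / (2 * B)"] True by (simp add: field_simps)
  qed
  then show ?thesis
    using True by simp
next
  case False
  then have C: "C < 0"
    using assms(2) by simp
  have "A - B\<^sup>2 / C \<le> 0"
    using assms(1)[of "- B / C"] C by (simp add: power2_eq_square field_simps)
  then show ?thesis
    using C by (simp add: field_simps)
qed

text \<open>Reverse Cauchy--Schwarz: on the orthogonal complement of a timelike x the form is negative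
  semidefinite; applied to v and the component of g orthogonal to x.\<close>
lemma bil_orthogonal_Cauchy_Schwarz:
  fixes Q :: "real^'n^'n"
  assumes eh: "even_hyperbolic Q" and x: "bil Q x x > 0" and vx: "bil Q v x = 0"
  shows "(bil Q v g)\<^sup>2 \<le> - bil Q v v * ((bil Q g x)\<^sup>2 / bil Q x x - bil Q g g)"
proof -
  have sym: "transpose Q = Q"
    using eh unfolding even_hyperbolic_def by blast
  have x0: "x \<noteq> 0"
    using x by auto
  have nonpos: "bil Q w w \<le> 0" if "bil Q w x = 0" for w
    using bil_orthogonal_causal_nonpos[OF eh _ x0 that] x by simp
  define g' where "g' = g - (bil Q g x / bil Q x x) *\<^sub>R x"
  have g'x: "bil Q g' x = 0"
    using x by (simp add: g'_def)
  have "(bil Q v g')\<^sup>2 \<le> bil Q v v * bil Q g' g'"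
  proof (rule quadratic_nonpos_discriminant)
    show "bil Q v v + 2 * t * bil Q v g' + t\<^sup>2 * bil Q g' g' \<le> 0" for t
      using nonpos[of "v + t *\<^sub>R g'"] vx g'x bil_commute[OF sym, of g' v]
      by (simp add: algebra_simps power2_eq_square)
  qed (rule nonpos[OF g'x])
  moreover have "bil Q v g' = bil Q v g"
    using vx by (simp add: g'_def)
  moreover have "bil Q g' g' = bil Q g g - (bil Q g x)\<^sup>2 / bil Q x x"
    using x bil_commute[OF sym, of x g] by (simp add: g'_def algebra_simps power2_eq_square)
  ultimately show ?thesis
    by (simp add: algebra_simps)
qed

section \<open>Discreteness of the dual lattice\<close>

lemma finite_vec_box:
  assumes "finite S"
  shows "finite {y :: 'a^'n. \<forall>i. y $ i \<in> S}"
proof (rule finite_subset)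
  show "{y :: 'a^'n. \<forall>i. y $ i \<in> S} \<subseteq> (\<lambda>g. \<chi> i. g i) ` PiE UNIV (\<lambda>_. S)"
  proof
    fix y :: "'a^'n"
    assume "y \<in> {y. \<forall>i. y $ i \<in> S}"
    then have "(\<lambda>i. y $ i) \<in> PiE UNIV (\<lambda>_. S)"
      by auto
    then show "y \<in> (\<lambda>g. \<chi> i. g i) ` PiE UNIV (\<lambda>_. S)"
      by (rule rev_image_eqI) simp
  qed
qed (use assms in \<open>simp add: finite_PiE\<close>)

lemma finite_dual_lat_box:
  fixes Q :: "real^'n^'n"
  assumes sym: "transpose Q = Q" and nondeg: "det Q \<noteq> 0"
  shows "finite {v \<in> dual_lat Q. \<forall>i. \<bar>bil Q v (axis i 1)\<bar> \<le> B}"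
proof -
  have coord: "bil Q v (axis i 1) = (Q *v v) $ i" for v i
    using bil_commute[OF sym, of v "axis i 1"] by (simp add: bil_def inner_commute cart_eq_inner_axis)
  have "axis i 1 \<in> lat" for i :: 'n
    by (simp add: lat_def axis_def)
  then have "(*v) Q ` {v \<in> dual_lat Q. \<forall>i. \<bar>bil Q v (axis i 1)\<bar> \<le> B}
       \<subseteq> {y. \<forall>i. y $ i \<in> {k \<in> \<int>. \<bar>k\<bar> \<le> B}}"
    by (auto simp: dual_lat_def coord[symmetric])
  then have "finite ((*v) Q ` {v \<in> dual_lat Q. \<forall>i. \<bar>bil Q v (axis i 1)\<bar> \<le> B})"
    using finite_vec_box[OF finite_abs_int_segment] finite_subset by blast
  moreover have "inj ((*v) Q)"
    using inj_matrix_vector_mult nondeg invertible_det_nz by blast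
  ultimately show ?thesis
    using finite_imageD inj_on_subset by blast
qed

text \<open>The reverse Cauchy--Schwarz inequality bounds \<open>\<langle>v, e\<^sub>i\<rangle>\<close>, and these are the (integral)
  coordinates of Qv.\<close>
lemma finite_dual_orthogonal_to_bounded_unit:
  fixes Q :: "real^'n^'n"
  assumes eh: "even_hyperbolic Q"
  shows "finite {v \<in> dual_lat Q. - bil Q v v \<le> c \<and>
                   (\<exists>w. bil Q w w = 1 \<and> norm w \<le> R \<and> bil Q v w = 0)}"
proof -
  have sym: "transpose Q = Q" and nondeg: "det Q \<noteq> 0"
    using eh unfolding even_hyperbolic_def by blast+
  obtain K where K: "K > 0" "\<And>x y. \<bar>bil Q x y\<bar> \<le> norm x * norm y * K"
    using bil_bound by blast
  define Y where "Y = (K * R)\<^sup>2 + K"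
  have "{v \<in> dual_lat Q. - bil Q v v \<le> c \<and> (\<exists>w. bil Q w w = 1 \<and> norm w \<le> R \<and> bil Q v w = 0)}
      \<subseteq> {v \<in> dual_lat Q. \<forall>i. \<bar>bil Q v (axis i 1)\<bar> \<le> sqrt (c * Y)}"
  proof (intro subsetI CollectI conjI allI; elim CollectE conjE exE)
    fix v w i
    assume v: "v \<in> dual_lat Q" "- bil Q v v \<le> c"
      and w: "bil Q w w = 1" "norm w \<le> R" "bil Q v w = 0"
    show "v \<in> dual_lat Q"
      by (fact v(1))
    have "w \<noteq> 0"
      using w(1) by auto
    then have vv: "0 \<le> - bil Q v v"
      using bil_orthogonal_causal_nonpos[OF eh, of w v] w by simp
    define g :: "real^'n" where "g = axis i 1"
    have "\<bar>bil Q g w\<bar> \<le> K * R"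
      using K(2)[of g w] w(2) K(1) by (simp add: g_def mult.commute mult_left_mono order_trans)
    then have "(bil Q g w)\<^sup>2 \<le> (K * R)\<^sup>2"
      by (metis abs_ge_zero abs_le_square_iff abs_of_nonneg order_trans)
    moreover have "\<bar>bil Q g g\<bar> \<le> K"
      using K(2)[of g g] by (simp add: g_def)
    ultimately have XY: "(bil Q g w)\<^sup>2 / bil Q w w - bil Q g g \<le> Y"
      using w(1) by (simp add: Y_def)
    have "(bil Q v g)\<^sup>2 \<le> - bil Q v v * ((bil Q g w)\<^sup>2 / bil Q w w - bil Q g g)"
      by (rule bil_orthogonal_Cauchy_Schwarz[OF eh]) (use w in simp_all)
    also have "\<dots> \<le> - bil Q v v * Y"
      using XY vv by (rule mult_left_mono)
    also have "\<dots> \<le> c * Y"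
      using v(2) K(1) by (intro mult_right_mono) (simp_all add: Y_def)
    finally show "\<bar>bil Q v (axis i 1)\<bar> \<le> sqrt (c * Y)"
      by (metis g_def real_sqrt_abs real_sqrt_le_mono)
  qed
  then show ?thesis
    using finite_dual_lat_box[OF sym nondeg] by (rule finite_subset)
qed

text \<open>This is where the integrality of the walls enters: a wall \<open>v\<^sup>\<perp>\<close> crossing the slice
  \<open>\<langle>z, f\<rangle> = 1\<close> at a point with \<open>\<langle>z, z\<rangle> > -\<langle>v, v\<rangle>\<close> must contain f.\<close>
lemma isotropic_pairing_vanishes:
  fixes Q :: "real^'n^'n"
  assumes eh: "even_hyperbolic Q" and ff: "bil Q f f = 0"
    and int: "bil Q v f \<in> \<int>" and vz: "bil Q v z = 0" and zf: "bil Q z f = 1"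
    and zz: "0 < bil Q z z" and small: "- bil Q v v < bil Q z z"
  shows "bil Q v f = 0"
proof (rule Ints_nonzero_abs_less1[OF int])
  have sym: "transpose Q = Q"
    using eh unfolding even_hyperbolic_def by blast
  have "(bil Q v f)\<^sup>2 \<le> - bil Q v v * ((bil Q f z)\<^sup>2 / bil Q z z - bil Q f f)"
    by (rule bil_orthogonal_Cauchy_Schwarz[OF eh zz vz])
  also have "\<dots> = - bil Q v v / bil Q z z"
    using zf ff bil_commute[OF sym, of f z] by simp
  also have "\<dots> < 1"
    using small zz by (simp add: field_simps)
  finally show "\<bar>bil Q v f\<bar> < 1"
    by (simp add: abs_square_less_1)
qed

section \<open>Chambers meeting a convex set\<close>

definition wall_complement :: "real^'n^'n \<Rightarrow> (real^'n) set \<Rightarrow> (real^'n) set \<Rightarrow> (real^'n) set"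
  where "wall_complement Q P V = P - (\<Union>v\<in>V. perp Q P v)"

definition chamber_of ::
    "real^'n^'n \<Rightarrow> (real^'n) set \<Rightarrow> (real^'n) set \<Rightarrow> real^'n \<Rightarrow> (real^'n) set"
  where "chamber_of Q P V z = closure (connected_component_set (wall_complement Q P V) z) \<inter> P"

lemma mem_wall_complement:
  "z \<in> wall_complement Q P V \<longleftrightarrow> z \<in> P \<and> (\<forall>v\<in>V. bil Q z v \<noteq> 0)"
  by (auto simp: wall_complement_def perp_def)

lemma chamber_meets_open_set:
  assumes "is_chamber Q P V D" "open U" "D \<inter> U \<noteq> {}"
  obtains z where "z \<in> U" "z \<in> wall_complement Q P V" "D = chamber_of Q P V z"
proof -
  obtain x where x: "x \<in> wall_complement Q P V" and D: "D = chamber_of Q P V x"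
    using assms(1) unfolding is_chamber_def wall_complement_def chamber_of_def by blast
  obtain y where "y \<in> closure (connected_component_set (wall_complement Q P V) x)" "y \<in> U"
    using assms(3) unfolding D chamber_of_def by blast
  then obtain z where z: "z \<in> connected_component_set (wall_complement Q P V) x" "z \<in> U"
    using assms(2) unfolding closure_iff_nhds_not_empty by blast
  have "z \<in> wall_complement Q P V"
    using z(1) connected_component_subset by blast
  moreover have "D = chamber_of Q P V z"
    unfolding D chamber_of_def using connected_component_eq[OF z(1)] by simp
  ultimately show thesis
    using that z(2) by blast
qed

text \<open>Inside a convex set, two points off the walls that no wall meeting the set separates
  are joined by their segment, which avoids all walls.\<close>
lemma chamber_of_eq_if_same_side:
  assumes "convex U" "U \<subseteq> P"
    and z: "z1 \<in> U" "z2 \<in> U" "z1 \<in> wall_complement Q P V" "z2 \<in> wall_complement Q P V"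
    and same_side: "\<And>v. v \<in> V \<Longrightarrow> \<exists>x\<in>U. bil Q x v = 0 \<Longrightarrow> bil Q z1 v > 0 \<longleftrightarrow> bil Q z2 v > 0"
  shows "chamber_of Q P V z1 = chamber_of Q P V z2"
proof -
  have "closed_segment z1 z2 \<subseteq> wall_complement Q P V"
  proof
    fix p
    assume p: "p \<in> closed_segment z1 z2"
    then obtain u where u: "0 \<le> u" "u \<le> 1" "p = (1 - u) *\<^sub>R z1 + u *\<^sub>R z2"
      by (auto simp: in_segment)
    have "p \<in> U"
      using p z(1,2) assms(1) closed_segment_subset by blast
    moreover have "bil Q p v \<noteq> 0" if v: "v \<in> V" for v
    proof (cases "\<exists>x\<in>U. bil Q x v = 0")
      case True
      have "bil Q z1 v \<noteq> 0" "bil Q z2 v \<noteq> 0"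
        using z(3,4) v by (auto simp: mem_wall_complement)
      moreover have "bil Q p v = (1 - u) * bil Q z1 v + u * bil Q z2 v"
        using u(3) by simp
      moreover have "(1 - u) * a + u * b \<noteq> 0" if "a \<noteq> 0" "b \<noteq> 0" "a > 0 \<longleftrightarrow> b > 0"
        for a b :: real
      proof (cases "a > 0")
        case True
        then show ?thesis
          using that u(1,2) by (smt (verit) mult_nonneg_nonneg mult_pos_pos)
      next
        case False
        then show ?thesis
          using that u(1,2) by (smt (verit) mult_nonneg_nonpos mult_pos_neg)
      qed
      ultimately show ?thesis
        using same_side[OF v True] by simp
    next
      case False
      then show ?thesis
        using \<open>p \<in> U\<close> by blast
    qed
    ultimately show "p \<in> wall_complement Q P V"
      using assms(2) by (auto simp: mem_wall_complement)
  qed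
  then have "z2 \<in> connected_component_set (wall_complement Q P V) z1"
    by (meson connected_component_maximal connected_segment ends_in_segment subsetD)
  then show ?thesis
    unfolding chamber_of_def by (simp add: connected_component_eq)
qed

lemma finite_image_if_factors:
  assumes "finite (g ` X)" "\<And>x y. x \<in> X \<Longrightarrow> y \<in> X \<Longrightarrow> g x = g y \<Longrightarrow> h x = h y"
  shows "finite (h ` X)"
proof -
  have "h ` X \<subseteq> (\<lambda>a. h (inv_into X g a)) ` g ` X"
  proof
    fix b
    assume "b \<in> h ` X"
    then obtain x where x: "x \<in> X" "b = h x"
      by blast
    have "h (inv_into X g (g x)) = h x"
      using assms(2) x(1) inv_into_into[of "g x" g X] f_inv_into_f[of "g x" g X] by blast
    then have "b = (\<lambda>a. h (inv_into X g a)) (g x)"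
      using x(2) by simp
    then show "b \<in> (\<lambda>a. h (inv_into X g a)) ` g ` X"
      using x(1) by blast
  qed
  then show ?thesis
    using assms(1) finite_subset by blast
qed

text \<open>A chamber meeting U is determined by the side of each wall meeting U on which it lies.\<close>
lemma finite_chambers_meeting_convex_open:
  assumes "open U" "convex U" "U \<subseteq> P" and fin: "finite {v\<in>V. \<exists>x\<in>U. bil Q x v = 0}"
  shows "finite {D. is_chamber Q P V D \<and> D \<inter> U \<noteq> {}}"
proof -
  define X where "X = U \<inter> wall_complement Q P V"
  define side where "side z = {v\<in>V. (\<exists>x\<in>U. bil Q x v = 0) \<and> bil Q z v > 0}" for z
  have "{D. is_chamber Q P V D \<and> D \<inter> U \<noteq> {}} \<subseteq> chamber_of Q P V ` X"
  proof (intro subsetI, elim CollectE conjE)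
    fix D
    assume "is_chamber Q P V D" "D \<inter> U \<noteq> {}"
    then obtain z where "z \<in> X" "D = chamber_of Q P V z"
      using chamber_meets_open_set[OF _ assms(1)] unfolding X_def by blast
    then show "D \<in> chamber_of Q P V ` X"
      by blast
  qed
  moreover have "side ` X \<subseteq> Pow {v\<in>V. \<exists>x\<in>U. bil Q x v = 0}"
    by (auto simp: side_def)
  then have "finite (side ` X)"
    using fin by (simp add: finite_subset)
  then have "finite (chamber_of Q P V ` X)"
  proof (rule finite_image_if_factors)
    fix z1 z2
    assume z: "z1 \<in> X" "z2 \<in> X" and "side z1 = side z2"
    then have "bil Q z1 v > 0 \<longleftrightarrow> bil Q z2 v > 0" if "v \<in> V" "\<exists>x\<in>U. bil Q x v = 0" for v
      using that unfolding side_def by blast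
    with z show "chamber_of Q P V z1 = chamber_of Q P V z2"
      unfolding X_def by (intro chamber_of_eq_if_same_side[OF assms(2,3)]) auto
  qed
  ultimately show ?thesis
    by (rule finite_subset)
qed

section \<open>The positive cone and the cusp at f\<close>

lemma piL_eq_imp_horo_ratio_eq:
  assumes "bil Q x x > 0" "bil Q y y > 0" "piL Q x = piL Q y"
  shows "(bil Q y f)\<^sup>2 / bil Q y y = (bil Q x f)\<^sup>2 / bil Q x x"
proof -
  define c where "c = sqrt (bil Q y y) / sqrt (bil Q x x)"
  have "(1 / sqrt (bil Q x x)) *\<^sub>R x = (1 / sqrt (bil Q y y)) *\<^sub>R y"
    using assms(3) by (simp add: piL_def)
  then have "y = sqrt (bil Q y y) *\<^sub>R ((1 / sqrt (bil Q x x)) *\<^sub>R x)"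
    using assms(2) by simp
  also have "\<dots> = c *\<^sub>R x"
    by (simp add: c_def)
  finally have "y = c *\<^sub>R x" .
  moreover have "c \<noteq> 0"
    using assms(1,2) by (simp add: c_def)
  ultimately show ?thesis
    by (simp only: bil_scaleR_left bil_scaleR_right power_mult_distrib power2_eq_square) simp
qed

lemma bil_piL_self: "bil Q x x > 0 \<Longrightarrow> bil Q (piL Q x) (piL Q x) = 1"
  by (simp add: piL_def)

locale positive_cone =
  fixes Q :: "real^'n^'n" and P :: "(real^'n) set"
  assumes eh: "even_hyperbolic Q" and pc: "pos_component Q P"
begin

lemma bil_sym: "bil Q x y = bil Q y x"
proof -
  have "transpose Q = Q"
    using eh unfolding even_hyperbolic_def by blast
  then show ?thesis
    by (rule bil_commute)
qed

lemma P_eq_component: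
  obtains x0 where "P = connected_component_set {x. bil Q x x > 0} x0"
  using pc unfolding pos_component_def by blast

lemma bil_self_pos:
  assumes "x \<in> P"
  shows "bil Q x x > 0"
proof -
  obtain x0 where "P = connected_component_set {x. bil Q x x > 0} x0"
    by (rule P_eq_component)
  then show ?thesis
    using assms connected_component_subset by blast
qed

lemma open_P: "open P"
proof -
  have "open {x. bil Q x x > 0}"
    by (rule open_Collect_less) (intro continuous_intros)+
  then show ?thesis
    by (metis P_eq_component open_connected_component)
qed

lemma connected_P: "connected P"
  by (metis P_eq_component connected_connected_component)

lemma connected_subset_P:
  assumes "x \<in> P" "x \<in> T" "connected T" "T \<subseteq> {x. bil Q x x > 0}"
  shows "T \<subseteq> P"
proof -
  obtain x0 where "P = connected_component_set {x. bil Q x x > 0} x0"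
    by (rule P_eq_component)
  then have "P = connected_component_set {x. bil Q x x > 0} x"
    using assms(1) by (simp add: connected_component_eq)
  then show ?thesis
    by (metis assms(2-4) connected_component_maximal)
qed

text \<open>Two vectors of P cannot be orthogonal (the orthogonal complement of a timelike vector is
  negative definite), so by connectedness the pairing keeps the sign it has on the diagonal.\<close>
lemma bil_pos:
  assumes "x \<in> P" "y \<in> P"
  shows "bil Q x y > 0"
proof (rule ccontr)
  assume "\<not> bil Q x y > 0"
  have "connected ((\<lambda>z. bil Q x z) ` P)"
    by (rule connected_continuous_image[OF _ connected_P]) (intro continuous_intros)
  then have "0 \<in> (\<lambda>z. bil Q x z) ` P"
    by (rule connectedD_interval[of _ "bil Q x y" "bil Q x x"])
      (use assms \<open>\<not> bil Q x y > 0\<close> bil_self_pos[of x] in auto)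
  then obtain z where z: "z \<in> P" "bil Q x z = 0"
    by auto
  have "bil Q z z < 0"
    by (rule bil_orthogonal_timelike_neg[OF eh, of x])
      (use z bil_self_pos[OF assms(1)] bil_self_pos[of z] bil_sym in auto)
  then show False
    using bil_self_pos[OF z(1)] by simp
qed

lemma convex_P: "convex P"
  unfolding convex_contains_segment
proof (intro ballI)
  fix x y
  assume xy: "x \<in> P" "y \<in> P"
  have "bil Q z z > 0" if z: "z \<in> closed_segment x y" for z
  proof -
    obtain u where u: "0 \<le> u" "u \<le> 1" "z = (1 - u) *\<^sub>R x + u *\<^sub>R y"
      using z by (auto simp: in_segment)
    have "bil Q z z = (1 - u)\<^sup>2 * bil Q x x + 2 * (u * (1 - u)) * bil Q x y + u\<^sup>2 * bil Q y y"
      unfolding u(3) using bil_sym[of x y] by (simp add: algebra_simps power2_eq_square)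
    moreover have "(1 - u)\<^sup>2 * bil Q x x + u\<^sup>2 * bil Q y y > 0"
    proof (cases "u = 0")
      case False
      then have "u\<^sup>2 * bil Q y y > 0"
        using bil_self_pos[OF xy(2)] by simp
      then show ?thesis
        using bil_self_pos[OF xy(1)] by (simp add: add_nonneg_pos)
    qed (use bil_self_pos[OF xy(1)] in simp)
    moreover have "2 * (u * (1 - u)) * bil Q x y \<ge> 0"
      using bil_pos[OF xy] u(1,2) by simp
    ultimately show ?thesis
      by linarith
  qed
  then have "closed_segment x y \<subseteq> {z. bil Q z z > 0}"
    by blast
  then show "closed_segment x y \<subseteq> P"
    by (rule connected_subset_P[OF xy(1) ends_in_segment(1) connected_segment])
qed

end

lemma convex_tube:
  fixes f :: "'a::real_normed_vector"
  shows "convex {z. \<exists>s. norm (a *\<^sub>R z - s *\<^sub>R f) < r}"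
proof (rule convexI; elim CollectE exE; intro CollectI)
  fix x y sx sy and u v :: real
  assume x: "norm (a *\<^sub>R x - sx *\<^sub>R f) < r" and y: "norm (a *\<^sub>R y - sy *\<^sub>R f) < r"
    and uv: "0 \<le> u" "0 \<le> v" "u + v = 1"
  have "a *\<^sub>R (u *\<^sub>R x + v *\<^sub>R y) - (u * sx + v * sy) *\<^sub>R f
      = u *\<^sub>R (a *\<^sub>R x - sx *\<^sub>R f) + v *\<^sub>R (a *\<^sub>R y - sy *\<^sub>R f)"
    by (simp add: algebra_simps)
  then have "norm (a *\<^sub>R (u *\<^sub>R x + v *\<^sub>R y) - (u * sx + v * sy) *\<^sub>R f)
      \<le> u * norm (a *\<^sub>R x - sx *\<^sub>R f) + v * norm (a *\<^sub>R y - sy *\<^sub>R f)"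
    using uv by (metis abs_of_nonneg norm_scaleR norm_triangle_ineq)
  also have "\<dots> < r"
    using x y uv by (rule convex_bound_lt)
  finally show "\<exists>s. norm (a *\<^sub>R (u *\<^sub>R x + v *\<^sub>R y) - s *\<^sub>R f) < r"
    by blast
qed

locale isotropic_boundary = positive_cone +
  fixes f :: "real^'n"
  assumes f_closure: "f \<in> closure P" and f_nonzero: "f \<noteq> 0" and f_isotropic: "bil Q f f = 0"
begin

lemma bil_f_pos:
  assumes "x \<in> P"
  shows "bil Q x f > 0"
proof -
  have "closure P \<subseteq> {y. bil Q x y \<ge> 0}"
  proof (rule closure_minimal)
    show "P \<subseteq> {y. bil Q x y \<ge> 0}"
      using bil_pos[OF assms] by (auto intro: less_imp_le)
    show "closed {y. bil Q x y \<ge> 0}"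
      by (rule closed_Collect_le) (intro continuous_intros)+
  qed
  moreover have "bil Q x f \<noteq> 0"
  proof
    assume "bil Q x f = 0"
    then have "bil Q f f < 0"
      using bil_orthogonal_timelike_neg[OF eh bil_self_pos[OF assms], of f] f_nonzero bil_sym by auto
    then show False
      using f_isotropic by simp
  qed
  ultimately show ?thesis
    using f_closure by force
qed

text \<open>Since f is isotropic, the norm is affine along the lines x + t f.\<close>
lemma add_multiple_f_in_P:
  assumes x: "x \<in> P" and pos: "bil Q (x + t *\<^sub>R f) (x + t *\<^sub>R f) > 0"
  shows "x + t *\<^sub>R f \<in> P"
proof -
  have "bil Q z z > 0" if z: "z \<in> closed_segment x (x + t *\<^sub>R f)" for z
  proof -
    obtain u where u: "0 \<le> u" "u \<le> 1" "z = x + (u * t) *\<^sub>R f"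
      using z by (auto simp: in_segment algebra_simps)
    have "bil Q z z = (1 - u) * bil Q x x + u * bil Q (x + t *\<^sub>R f) (x + t *\<^sub>R f)"
      unfolding u(3) using f_isotropic bil_sym[of f x] by (simp add: algebra_simps)
    then show ?thesis
      using u(1,2) bil_self_pos[OF x] pos by (smt (verit) mult_nonneg_nonneg mult_pos_pos)
  qed
  then have "closed_segment x (x + t *\<^sub>R f) \<subseteq> {z. bil Q z z > 0}"
    by blast
  then show ?thesis
    using connected_subset_P[OF x ends_in_segment(1) connected_segment] by blast
qed

lemma horoball_piL_ratio:
  assumes "x \<in> P" "piL Q x \<in> horoball Q P f \<alpha>"
  shows "(bil Q x f)\<^sup>2 / bil Q x x \<le> \<alpha>"
proof -
  obtain y where "y \<in> P" "(bil Q y f)\<^sup>2 / bil Q y y \<le> \<alpha>" "piL Q x = piL Q y"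
    using assms(2) unfolding horoball_def by auto
  then show ?thesis
    using piL_eq_imp_horo_ratio_eq[of Q y x f] bil_self_pos assms(1) by simp
qed

definition f_normalize :: "real^'n \<Rightarrow> real^'n" where
  "f_normalize x = (1 / bil Q x f) *\<^sub>R x"

lemma bil_f_normalize_f: "x \<in> P \<Longrightarrow> bil Q (f_normalize x) f = 1"
  using bil_f_pos[of x] by (simp add: f_normalize_def)

lemma bil_f_normalize_self: "bil Q (f_normalize x) (f_normalize x) = bil Q x x / (bil Q x f)\<^sup>2"
  by (simp add: f_normalize_def power2_eq_square)

lemma horosphere_geodesic_point:
  assumes x: "x \<in> P" and \<alpha>: "\<alpha> > 0"
    and q: "q \<in> horosphere Q P f \<alpha>" "q \<in> geodesic_to Q P f (piL Q x)"
  shows "\<exists>m. q = sqrt \<alpha> *\<^sub>R f_normalize x + m *\<^sub>R f \<and> bil Q q q = 1"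
proof -
  obtain y where y: "y \<in> span {piL Q x, f}" "y \<in> P" "q = piL Q y"
    using q(2) unfolding geodesic_to_def by auto
  obtain y' where y': "y' \<in> P" "(bil Q y' f)\<^sup>2 / bil Q y' y' = \<alpha>" "q = piL Q y'"
    using q(1) unfolding horosphere_def by auto
  have ratio: "(bil Q y f)\<^sup>2 / bil Q y y = \<alpha>"
    using piL_eq_imp_horo_ratio_eq[of Q y' y f] y y' bil_self_pos by simp
  have ypos: "bil Q y y > 0" "bil Q y f > 0"
    using bil_self_pos[OF y(2)] bil_f_pos[OF y(2)] by auto
  have "bil Q q f = bil Q y f / sqrt (bil Q y y)"
    using y(3) by (simp add: piL_def)
  also have "\<dots> = sqrt ((bil Q y f)\<^sup>2 / bil Q y y)"
    using ypos by (simp add: real_sqrt_divide)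
  also have "\<dots> = sqrt \<alpha>"
    using ratio by simp
  finally have qf: "bil Q q f = sqrt \<alpha>" .
  obtain k m' where "y = (k / sqrt (bil Q x x)) *\<^sub>R x + m' *\<^sub>R f"
  proof -
    obtain k where "y - k *\<^sub>R piL Q x \<in> span {f}"
      using y(1) span_breakdown_eq[of y "piL Q x" "{f}"] by auto
    then obtain m' where "y - k *\<^sub>R piL Q x = m' *\<^sub>R f"
      by (auto simp: span_singleton)
    then show thesis
      using that[of k m'] by (simp add: piL_def algebra_simps)
  qed
  then obtain s m where qform: "q = s *\<^sub>R x + m *\<^sub>R f"
    unfolding y(3) piL_def by (metis scaleR_add_right scaleR_scaleR)
  have "s * bil Q x f = sqrt \<alpha>"
    using qf f_isotropic unfolding qform by simp
  then have "s *\<^sub>R x = sqrt \<alpha> *\<^sub>R f_normalize x"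
    using bil_f_pos[OF x] by (simp add: f_normalize_def field_simps)
  then have "q = sqrt \<alpha> *\<^sub>R f_normalize x + m *\<^sub>R f"
    using qform by simp
  moreover have "bil Q q q = 1"
    using y(3) bil_piL_self ypos(1) by simp
  ultimately show ?thesis
    by blast
qed

lemma rho_piL:
  assumes x: "x \<in> P" and \<alpha>: "\<alpha> > 0"
  shows "\<exists>m. rho Q P f \<alpha> (piL Q x) = sqrt \<alpha> *\<^sub>R f_normalize x + m *\<^sub>R f"
proof -
  define a where "a = bil Q x f"
  have a: "a > 0"
    using bil_f_pos[OF x] by (simp add: a_def)
  have sq: "bil Q (x + t *\<^sub>R f) (x + t *\<^sub>R f) = bil Q x x + 2 * t * a" for t
    using f_isotropic bil_sym[of f x] by (simp add: a_def algebra_simps)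
  define y where "y = x + ((a\<^sup>2 / \<alpha> - bil Q x x) / (2 * a)) *\<^sub>R f"
  have yy: "bil Q y y = a\<^sup>2 / \<alpha>"
    unfolding y_def sq using a by (simp add: field_simps)
  then have yP: "y \<in> P"
    using add_multiple_f_in_P[OF x] a \<alpha> unfolding y_def by simp
  have "(bil Q y f)\<^sup>2 / bil Q y y = \<alpha>"
    using yy a \<alpha> f_isotropic by (simp add: y_def a_def)
  moreover have "y \<in> span {piL Q x, f}"
  proof -
    have "x = sqrt (bil Q x x) *\<^sub>R piL Q x"
      using bil_self_pos[OF x] by (simp add: piL_def)
    then show ?thesis
      unfolding y_def by (metis span_add span_base span_scale insertI1 insert_subset subset_insertI)
  qed
  ultimately have ex: "piL Q y \<in> horosphere Q P f \<alpha> \<and> piL Q y \<in> geodesic_to Q P f (piL Q x)"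
    unfolding horosphere_def geodesic_to_def using yP by auto
  have unique: "q1 = q2"
    if q: "q1 \<in> horosphere Q P f \<alpha> \<and> q1 \<in> geodesic_to Q P f (piL Q x)"
      "q2 \<in> horosphere Q P f \<alpha> \<and> q2 \<in> geodesic_to Q P f (piL Q x)" for q1 q2
  proof -
    have sq': "bil Q (sqrt \<alpha> *\<^sub>R f_normalize x + m *\<^sub>R f) (sqrt \<alpha> *\<^sub>R f_normalize x + m *\<^sub>R f)
        = \<alpha> * bil Q (f_normalize x) (f_normalize x) + 2 * sqrt \<alpha> * m" for m
      using f_isotropic bil_sym[of f "f_normalize x"] bil_f_normalize_f[OF x] \<alpha>
      by (simp add: algebra_simps)
    obtain m1 m2 where m:
      "q1 = sqrt \<alpha> *\<^sub>R f_normalize x + m1 *\<^sub>R f" "bil Q q1 q1 = 1"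
      "q2 = sqrt \<alpha> *\<^sub>R f_normalize x + m2 *\<^sub>R f" "bil Q q2 q2 = 1"
      using horosphere_geodesic_point[OF x \<alpha>] q by meson
    then have "2 * sqrt \<alpha> * m1 = 2 * sqrt \<alpha> * m2"
      using sq'[of m1] sq'[of m2] by (metis add_left_cancel)
    then show ?thesis
      using m(1,3) \<alpha> by simp
  qed
  have "rho Q P f \<alpha> (piL Q x) \<in> horosphere Q P f \<alpha> \<and>
        rho Q P f \<alpha> (piL Q x) \<in> geodesic_to Q P f (piL Q x)"
    unfolding rho_def by (rule theI[of _ "piL Q y"]) (use ex unique in blast)+
  then show ?thesis
    using horosphere_geodesic_point[OF x \<alpha>] by blast
qed


text \<open>The point \<open>\<rho>\<^sub>b\<close> of x is \<open>\<surd>\<alpha> z\<close> plus a multiple of f, where z is the slice image of x;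
  the tube condition asks that some such translate have norm below r.\<close>
definition cusp_region :: "real \<Rightarrow> real \<Rightarrow> real \<Rightarrow> (real^'n) set" where
  "cusp_region \<alpha> c r = {x \<in> P. (\<exists>s. norm (sqrt \<alpha> *\<^sub>R f_normalize x - s *\<^sub>R f) < r) \<and>
                               c < bil Q (f_normalize x) (f_normalize x)}"

lemma horo_cylinder_subset_cusp_region:
  assumes \<alpha>: "0 < \<alpha>" "\<alpha> * c < 1" and J: "\<And>q. q \<in> J \<Longrightarrow> norm q < r"
  shows "{x \<in> P. piL Q x \<in> horoball Q P f \<alpha> \<and> rho Q P f \<alpha> (piL Q x) \<in> J} \<subseteq> cusp_region \<alpha> c r"
proof (intro subsetI, elim CollectE conjE)
  fix x
  assume x: "x \<in> P" "piL Q x \<in> horoball Q P f \<alpha>" "rho Q P f \<alpha> (piL Q x) \<in> J"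
  have pos: "bil Q x x > 0" "bil Q x f > 0"
    using bil_self_pos[OF x(1)] bil_f_pos[OF x(1)] by auto
  have "(bil Q x f)\<^sup>2 \<le> \<alpha> * bil Q x x"
    using horoball_piL_ratio[OF x(1,2)] pos by (simp add: divide_le_eq)
  then have "1 / \<alpha> \<le> bil Q (f_normalize x) (f_normalize x)"
    using \<alpha>(1) pos unfolding bil_f_normalize_self by (simp add: field_simps)
  moreover have "c < 1 / \<alpha>"
    using \<alpha> by (simp add: field_simps)
  moreover obtain m where "rho Q P f \<alpha> (piL Q x) = sqrt \<alpha> *\<^sub>R f_normalize x + m *\<^sub>R f"
    using rho_piL[OF x(1) \<alpha>(1)] by blast
  then have "norm (sqrt \<alpha> *\<^sub>R f_normalize x - (- m) *\<^sub>R f) < r"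
    using J[OF x(3)] by simp
  ultimately show "x \<in> cusp_region \<alpha> c r"
    unfolding cusp_region_def using x(1) by fastforce
qed

lemma open_cusp_region: "open (cusp_region \<alpha> c r)"
proof -
  have "continuous_on P f_normalize"
    unfolding f_normalize_def by (intro continuous_intros) (auto dest: bil_f_pos)
  moreover have "open ({z. \<exists>s. norm (sqrt \<alpha> *\<^sub>R z - s *\<^sub>R f) < r} \<inter> {z. c < bil Q z z})"
  proof (rule open_Int)
    have "{z. \<exists>s. norm (sqrt \<alpha> *\<^sub>R z - s *\<^sub>R f) < r} = (\<Union>s. {z. norm (sqrt \<alpha> *\<^sub>R z - s *\<^sub>R f) < r})"
      by blast
    moreover have "open {z. norm (sqrt \<alpha> *\<^sub>R z - s *\<^sub>R f) < r}" for s
      by (rule open_Collect_less) (intro continuous_intros)+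
    ultimately show "open {z. \<exists>s. norm (sqrt \<alpha> *\<^sub>R z - s *\<^sub>R f) < r}"
      by auto
    show "open {z. c < bil Q z z}"
      by (rule open_Collect_less) (intro continuous_intros)+
  qed
  ultimately have "open (P \<inter> f_normalize -` ({z. \<exists>s. norm (sqrt \<alpha> *\<^sub>R z - s *\<^sub>R f) < r} \<inter> {z. c < bil Q z z}))"
    using continuous_open_preimage[OF _ open_P] by blast
  moreover have "cusp_region \<alpha> c r
      = P \<inter> f_normalize -` ({z. \<exists>s. norm (sqrt \<alpha> *\<^sub>R z - s *\<^sub>R f) < r} \<inter> {z. c < bil Q z z})"
    by (auto simp: cusp_region_def)
  ultimately show ?thesis
    by simp
qed

lemma f_normalize_convex_combination:
  assumes "x \<in> P" "y \<in> P" "0 \<le> u" "0 \<le> v" "u + v = 1"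
  shows "\<exists>l m. 0 \<le> l \<and> 0 \<le> m \<and> l + m = 1 \<and>
           f_normalize (u *\<^sub>R x + v *\<^sub>R y) = l *\<^sub>R f_normalize x + m *\<^sub>R f_normalize y"
proof -
  define ap where "ap = bil Q (u *\<^sub>R x + v *\<^sub>R y) f"
  have "u *\<^sub>R x + v *\<^sub>R y \<in> P"
    using convexD[OF convex_P] assms by blast
  then have pos: "bil Q x f > 0" "bil Q y f > 0" "ap > 0"
    unfolding ap_def using bil_f_pos assms(1,2) by blast+
  have ap: "ap = u * bil Q x f + v * bil Q y f"
    by (simp add: ap_def)
  show ?thesis
  proof (intro exI conjI)
    show "0 \<le> u * bil Q x f / ap" "0 \<le> v * bil Q y f / ap"
      using assms pos by simp_all
    show "u * bil Q x f / ap + v * bil Q y f / ap = 1"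
      using ap pos by (simp add: add_divide_distrib[symmetric])
    have "f_normalize (u *\<^sub>R x + v *\<^sub>R y) = (1 / ap) *\<^sub>R (u *\<^sub>R x + v *\<^sub>R y)"
      by (simp only: f_normalize_def ap_def)
    also have "\<dots> = (u * bil Q x f / ap) *\<^sub>R f_normalize x + (v * bil Q y f / ap) *\<^sub>R f_normalize y"
      using pos by (simp add: f_normalize_def scaleR_add_right)
    finally show "f_normalize (u *\<^sub>R x + v *\<^sub>R y)
        = (u * bil Q x f / ap) *\<^sub>R f_normalize x + (v * bil Q y f / ap) *\<^sub>R f_normalize y" .
  qed
qed

text \<open>Two points of the slice differ by a vector orthogonal to the isotropic f, whose norm is
  therefore non-positive; so the norm is concave along the slice.\<close>
lemma convex_slice_superlevel: "convex {z. bil Q z f = 1 \<and> c < bil Q z z}"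
proof (rule convexI; elim CollectE conjE; intro CollectI conjI)
  fix z1 z2 and u v :: real
  assume z: "bil Q z1 f = 1" "c < bil Q z1 z1" "bil Q z2 f = 1" "c < bil Q z2 z2"
    and uv: "0 \<le> u" "0 \<le> v" "u + v = 1"
  show "bil Q (u *\<^sub>R z1 + v *\<^sub>R z2) f = 1"
    using z uv by simp
  have v: "v = 1 - u"
    using uv by simp
  have "bil Q (z1 - z2) (z1 - z2) \<le> 0"
    using bil_orthogonal_causal_nonpos[OF eh, of f "z1 - z2"] z f_nonzero f_isotropic by simp
  then have "u * (1 - u) * bil Q (z1 - z2) (z1 - z2) \<le> 0"
    using uv by (simp add: mult_nonneg_nonpos v)
  then have "u * bil Q z1 z1 + v * bil Q z2 z2 \<le> bil Q (u *\<^sub>R z1 + v *\<^sub>R z2) (u *\<^sub>R z1 + v *\<^sub>R z2)"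
    unfolding v bil_convex_combination by linarith
  moreover have "c < u * bil Q z1 z1 + v * bil Q z2 z2"
    using convex_bound_lt[of "- bil Q z1 z1" "- c" "- bil Q z2 z2" u v] z uv by simp
  ultimately show "c < bil Q (u *\<^sub>R z1 + v *\<^sub>R z2) (u *\<^sub>R z1 + v *\<^sub>R z2)"
    by linarith
qed

lemma convex_cusp_region: "convex (cusp_region \<alpha> c r)"
proof -
  define S where "S = {z. \<exists>s. norm (sqrt \<alpha> *\<^sub>R z - s *\<^sub>R f) < r} \<inter> {z. bil Q z f = 1 \<and> c < bil Q z z}"
  have S: "convex S"
    unfolding S_def by (intro convex_Int convex_tube convex_slice_superlevel)
  have region: "cusp_region \<alpha> c r = {x \<in> P. f_normalize x \<in> S}"
    using bil_f_normalize_f by (auto simp: cusp_region_def S_def)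
  show ?thesis
    unfolding region
  proof (rule convexI; elim CollectE conjE; intro CollectI conjI)
    fix x y and u v :: real
    assume x: "x \<in> P" "f_normalize x \<in> S" and y: "y \<in> P" "f_normalize y \<in> S"
      and uv: "0 \<le> u" "0 \<le> v" "u + v = 1"
    show "u *\<^sub>R x + v *\<^sub>R y \<in> P"
      using convexD[OF convex_P x(1) y(1) uv] .
    obtain l m where "0 \<le> l" "0 \<le> m" "l + m = 1"
      and "f_normalize (u *\<^sub>R x + v *\<^sub>R y) = l *\<^sub>R f_normalize x + m *\<^sub>R f_normalize y"
      using f_normalize_convex_combination[OF x(1) y(1) uv] by blast
    then show "f_normalize (u *\<^sub>R x + v *\<^sub>R y) \<in> S"
      using convexD[OF S x(2) y(2)] by simp
  qed
qed

text \<open>Moving a point of the cusp region along f onto the hyperboloid \<open>\<langle>w, w\<rangle> = 1\<close> lands in a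
  bounded set: the tube condition bounds the start, and the pairing with f (equal to \<open>\<surd>\<alpha>\<close>)
  bounds the length of the move.\<close>
lemma cusp_region_lift_bounded:
  assumes \<alpha>: "0 < \<alpha>"
  shows "\<exists>R. \<forall>x \<in> cusp_region \<alpha> c r. \<exists>w t. bil Q w w = 1 \<and> norm w \<le> R \<and>
                                           w = sqrt \<alpha> *\<^sub>R f_normalize x + t *\<^sub>R f"
proof -
  obtain K where K: "K > 0" "\<And>x y. \<bar>bil Q x y\<bar> \<le> norm x * norm y * K"
    using bil_bound by blast
  have sa: "sqrt \<alpha> > 0"
    using \<alpha> by simp
  define R where "R = r + (1 + r * r * K) / (2 * sqrt \<alpha>) * norm f"
  have "\<exists>w t. bil Q w w = 1 \<and> norm w \<le> R \<and> w = sqrt \<alpha> *\<^sub>R f_normalize x + t *\<^sub>R f"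
    if x: "x \<in> cusp_region \<alpha> c r" for x
  proof -
    obtain s where ws: "norm (sqrt \<alpha> *\<^sub>R f_normalize x - s *\<^sub>R f) < r"
      using x by (auto simp: cusp_region_def)
    define w where "w = sqrt \<alpha> *\<^sub>R f_normalize x - s *\<^sub>R f"
    have wf: "bil Q w f = sqrt \<alpha>"
      using x bil_f_normalize_f f_isotropic by (simp add: w_def cusp_region_def)
    define t where "t = (1 - bil Q w w) / (2 * sqrt \<alpha>)"
    have "bil Q (w + t *\<^sub>R f) (w + t *\<^sub>R f) = bil Q w w + 2 * t * sqrt \<alpha>"
      using wf bil_sym[of f w] f_isotropic by (simp add: algebra_simps)
    moreover have "2 * t * sqrt \<alpha> = 1 - bil Q w w"
      using sa by (simp add: t_def)
    ultimately have unit: "bil Q (w + t *\<^sub>R f) (w + t *\<^sub>R f) = 1"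
      by simp
    have nw: "norm w < r"
      using ws by (simp add: w_def)
    have r: "0 \<le> r"
      using nw norm_ge_zero[of w] by linarith
    have "\<bar>bil Q w w\<bar> \<le> norm w * norm w * K"
      by (rule K(2))
    also have "\<dots> \<le> r * r * K"
      using nw r K(1) by (intro mult_right_mono mult_mono) simp_all
    finally have "\<bar>t\<bar> \<le> (1 + r * r * K) / (2 * sqrt \<alpha>)"
      using sa by (simp add: t_def abs_divide divide_right_mono abs_le_iff)
    then have "\<bar>t\<bar> * norm f \<le> (1 + r * r * K) / (2 * sqrt \<alpha>) * norm f"
      by (rule mult_right_mono) simp
    then have "norm (w + t *\<^sub>R f) \<le> R"
      using nw norm_triangle_ineq[of w "t *\<^sub>R f"] unfolding R_def by simp
    moreover have "w + t *\<^sub>R f = sqrt \<alpha> *\<^sub>R f_normalize x + (t - s) *\<^sub>R f"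
      by (simp add: w_def algebra_simps)
    ultimately show ?thesis
      using unit by blast
  qed
  then show ?thesis
    by blast
qed

lemma finite_walls_meeting_cusp_region:
  assumes f: "f \<in> lat" and V: "V \<subseteq> dual_lat Q" "\<And>v. v \<in> V \<Longrightarrow> - bil Q v v < c"
    and c: "0 < c" and \<alpha>: "0 < \<alpha>"
  shows "finite {v \<in> V. \<exists>x \<in> cusp_region \<alpha> c r. bil Q x v = 0}"
proof -
  from cusp_region_lift_bounded[OF \<alpha>] obtain R where R: "\<forall>x \<in> cusp_region \<alpha> c r.
      \<exists>w t. bil Q w w = 1 \<and> norm w \<le> R \<and> w = sqrt \<alpha> *\<^sub>R f_normalize x + t *\<^sub>R f" ..
  have "{v \<in> V. \<exists>x \<in> cusp_region \<alpha> c r. bil Q x v = 0}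
      \<subseteq> {v \<in> dual_lat Q. - bil Q v v \<le> c \<and> (\<exists>w. bil Q w w = 1 \<and> norm w \<le> R \<and> bil Q v w = 0)}"
  proof
    fix v
    assume "v \<in> {v \<in> V. \<exists>x \<in> cusp_region \<alpha> c r. bil Q x v = 0}"
    then obtain x where v: "v \<in> V" and x: "x \<in> cusp_region \<alpha> c r" "bil Q x v = 0"
      by blast
    have xP: "x \<in> P"
      using x(1) by (simp add: cusp_region_def)
    have vz: "bil Q v (f_normalize x) = 0"
      using x(2) bil_sym[of x v] by (simp add: f_normalize_def)
    have big: "c < bil Q (f_normalize x) (f_normalize x)"
      using x(1) by (simp add: cusp_region_def)
    have vf: "bil Q v f = 0"
    proof (rule isotropic_pairing_vanishes[OF eh f_isotropic _ vz bil_f_normalize_f[OF xP]])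
      show "bil Q v f \<in> \<int>"
        using V(1) v f by (auto simp: dual_lat_def)
      show "0 < bil Q (f_normalize x) (f_normalize x)"
        using big c by linarith
      show "- bil Q v v < bil Q (f_normalize x) (f_normalize x)"
        using big V(2)[OF v] by linarith
    qed
    obtain w t where w: "bil Q w w = 1" "norm w \<le> R" "w = sqrt \<alpha> *\<^sub>R f_normalize x + t *\<^sub>R f"
      using R x(1) by blast
    then have "bil Q v w = 0"
      using vz vf by simp
    moreover have "v \<in> dual_lat Q" "- bil Q v v \<le> c"
      using V v by (auto intro: less_imp_le)
    ultimately show "v \<in> {v \<in> dual_lat Q. - bil Q v v \<le> c \<and>
        (\<exists>w. bil Q w w = 1 \<and> norm w \<le> R \<and> bil Q v w = 0)}"
      using w(1,2) by blast
  qed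
  then show ?thesis
    using finite_dual_orthogonal_to_bounded_unit[OF eh] by (rule finite_subset)
qed

lemma finite_chambers_meeting_cusp_region:
  assumes "f \<in> lat" "V \<subseteq> dual_lat Q" "\<And>v. v \<in> V \<Longrightarrow> - bil Q v v < c" "0 < c" "0 < \<alpha>"
  shows "finite {D. is_chamber Q P V D \<and> D \<inter> cusp_region \<alpha> c r \<noteq> {}}"
  by (rule finite_chambers_meeting_convex_open[OF open_cusp_region convex_cusp_region _
        finite_walls_meeting_cusp_region[OF assms]]) (auto simp: cusp_region_def)

end

theorem corollary3p13:
  fixes Q :: "real^'n^'n" and P :: "(real^'n) set" and G :: "(real^'n^'n) set"
    and V :: "(real^'n) set" and f :: "real^'n"
  assumes "even_hyperbolic Q"
    and "pos_component Q P"
    and "finite_index_subgroup Q P G"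
    and "V \<subseteq> neg_vecs Q \<inter> dual_lat Q"
    and "V1 Q V" and "V2 G V" and "V3 Q P V" and "V4 Q P V"
    and "f \<in> closure P \<inter> lat" and "f \<noteq> 0" and "bil Q f f = 0"
  shows "\<exists>\<alpha>0>0. \<forall>\<alpha>. 0 < \<alpha> \<and> \<alpha> \<le> \<alpha>0 \<longrightarrow>
           (\<forall>J. compact J \<and> J \<subseteq> horosphere Q P f \<alpha> \<longrightarrow>
              finite {D. is_chamber Q P V D \<and>
                         D \<inter> {x\<in>P. piL Q x \<in> horoball Q P f \<alpha> \<and>
                                   rho Q P f \<alpha> (piL Q x) \<in> J} \<noteq> {}})"
proof -
  interpret isotropic_boundary Q P f
    using assms by unfold_locales auto
  obtain c where c: "c > 0" "\<And>v. v \<in> V \<Longrightarrow> - bil Q v v < c"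
    using assms(5) unfolding V1_def by blast
  show ?thesis
  proof (intro exI[of _ "1 / (2 * c)"] conjI allI impI)
    fix \<alpha> J
    assume \<alpha>: "0 < \<alpha> \<and> \<alpha> \<le> 1 / (2 * c)" and J: "compact J \<and> J \<subseteq> horosphere Q P f \<alpha>"
    let ?R = "{x \<in> P. piL Q x \<in> horoball Q P f \<alpha> \<and> rho Q P f \<alpha> (piL Q x) \<in> J}"
    obtain r where r: "\<And>q. q \<in> J \<Longrightarrow> norm q < r"
      using J compact_imp_bounded bounded_pos_less by metis
    have fin: "finite {D. is_chamber Q P V D \<and> D \<inter> cusp_region \<alpha> c r \<noteq> {}}"
      using assms(4,9) c \<alpha> by (intro finite_chambers_meeting_cusp_region) auto
    have "\<alpha> * c < 1"
      using \<alpha> c(1) by (simp add: field_simps)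
    then have "?R \<subseteq> cusp_region \<alpha> c r"
      using \<alpha> by (intro horo_cylinder_subset_cusp_region r) simp_all
    then show "finite {D. is_chamber Q P V D \<and> D \<inter> ?R \<noteq> {}}"
      by (intro rev_finite_subset[OF fin]) blast
  qed (use c in simp)
qed

end
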